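(* There are precisely seven Euclidean consonants in the group of musical intervals $\mathfrak{S}$, namely the minor third $\big[\tfrac{5}{6}\big]$, the major third $\big[\tfrac{4}{5}\big]$, the fourth $\big[\tfrac{3}{4}\big]$, the fifth $\big[\tfrac{2}{3}\big]$, the minor sixth $\big[\tfrac{5}{8}\big]$, the major sixth $\big[\tfrac{3}{5}\big]$, and the octave $\big[\tfrac{1}{2}\big]$. That is, the set of Euclidean consonant elements of $\mathfrak{S}$ equals $$\Big\{\big[\tfrac{5}{6}\big], \big[\tfrac{4}{5}\big], \big[\tfrac{3}{4}\big], \big[\tfrac{2}{3}\big], \big[\tfrac{5}{8}\big], \big[\tfrac{3}{5}\big], \big[\tfrac{1}{2}\big]\Big\},$$ and these seven elements are distinct.
   Context: Let $\mathbb{Q}_+=\{q\in\mathbb{Q}: q>0\}$ with the equivalence relation $q_1\sim q_2$ if and only if $q_1=2^n q_2$ for some $n\in\mathbb{Z}$. The quotient $\mathfrak{S}=\mathbb{Q}_+/\sim$ is an abelian group (under multiplication), called the group of musical intervals; its elements are called musical intervals, and $[q]$ denotes the class of $q\in\mathbb{Q}_+$. The neutral element is $\mathfrak{o}=[1]=[\tfrac12]$, called the octave. For each $\sigma\in\mathfrak{S}$ there are unique positive integers $n_\sigma,m_\sigma$ with $$\sigma=\Big[\frac{m_\sigma}{n_\sigma}\Big],\qquad \frac12\le \frac{m_\sigma}{n_\sigma}<1,\qquad \gcd(n_\sigma,m_\sigma)=1.$$ Define $\mathcal{N}\colon\mathfrak{S}\to\mathbb{N}$ by $\mathcal{N}(\sigma)=n_\sigma$.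 The Kepler map is $K\colon\mathfrak{S}\to\mathfrak{S}$, $K(\sigma)=\big[\tfrac{n_\sigma-m_\sigma}{m_\sigma}\big]$ (well defined since $n_\sigma>m_\sigma$). The height of $\sigma\in\mathfrak{S}$ is $\mathfrak{h}(\sigma)=\min\{\ell\in\mathbb{N}_0: K^\ell(\sigma)=\mathfrak{o}\}$, where $\mathbb{N}_0=\{0,1,2,\ldots\}$; such an $\ell$ exists for every $\sigma$. The second Kepler sequence of $\sigma$ is $$\mathfrak{K}_2(\sigma)=\big(\mathcal{N}(\sigma),\mathcal{N}(K(\sigma)),\ldots,\mathcal{N}(K^{\mathfrak{h}(\sigma)}(\sigma))\big).$$ A Euclidean Gauss-Wantzel number is an integer $n>1$ of the form $n=2^k3^\ell5^m$ with $k\in\mathbb{N}_0$ and $\ell,m\in\{0,1\}$; $\mathfrak{E}$ denotes the set of these numbers. A musical interval $\sigma\in\mathfrak{S}$ is called Euclidean consonant (a Euclidean consonant) if $\mathfrak{K}_2(\sigma)\in\mathfrak{E}^{\mathfrak{h}(\sigma)+1}$, i.e. all members of its second Kepler sequence belong to $\mathfrak{E}$. *)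

theory Defs
  imports Complex_Main "HOL-Algebra.Group"
begin

definition octave_rel :: "(rat \<times> rat) set" where
  "octave_rel = {(p, q). 0 < p \<and> 0 < q \<and> (\<exists>n::int. p = 2 powi n * q)}"

text \<open>The class of a positive rational \<open>q\<close>; it is the empty set, hence not a musical
  interval, if \<open>q \<le> 0\<close>.\<close>

definition musical_interval :: "rat \<Rightarrow> rat set" where
  "musical_interval q = octave_rel `` {q}"

definition musical_group :: "rat set monoid" where
  "musical_group =
     \<lparr>carrier = {q. 0 < q} // octave_rel,
      monoid.mult = (\<lambda>\<sigma> \<tau>. \<Union>p\<in>\<sigma>. \<Union>q\<in>\<tau>. musical_interval (p * q)),
      one = musical_interval 1\<rparr>"

abbreviation octave :: "rat set" where
  "octave \<equiv> \<one>\<^bsub>musical_group\<^esub>"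

text \<open>\<open>is_normal_fraction \<sigma> (m, n)\<close> says that \<open>m\<close> and \<open>n\<close> are the numerator and the denominator
  of the reduced representative of \<open>\<sigma>\<close> in \<open>[1/2, 1)\<close>.\<close>

definition is_normal_fraction :: "rat set \<Rightarrow> nat \<times> nat \<Rightarrow> bool" where
  "is_normal_fraction \<sigma> = (\<lambda>(m, n).
     0 < m \<and> 0 < n \<and> \<sigma> = musical_interval (of_nat m / of_nat n) \<and>
     1 / 2 \<le> (of_nat m / of_nat n :: rat) \<and> (of_nat m / of_nat n :: rat) < 1 \<and>
     coprime n m)"

definition interval_num :: "rat set \<Rightarrow> nat" where
  "interval_num \<sigma> = fst (THE mn. is_normal_fraction \<sigma> mn)"

definition interval_den :: "rat set \<Rightarrow> nat" where
  "interval_den \<sigma> = snd (THE mn. is_normal_fraction \<sigma> mn)"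

definition kepler :: "rat set \<Rightarrow> rat set" where
  "kepler \<sigma> =
     musical_interval ((of_nat (interval_den \<sigma>) - of_nat (interval_num \<sigma>)) / of_nat (interval_num \<sigma>))"

definition kepler_height :: "rat set \<Rightarrow> nat" where
  "kepler_height \<sigma> = (LEAST l. (kepler ^^ l) \<sigma> = octave)"

definition second_kepler_seq :: "rat set \<Rightarrow> nat list" where
  "second_kepler_seq \<sigma> =
     map (\<lambda>j. interval_den ((kepler ^^ j) \<sigma>)) [0..<kepler_height \<sigma> + 1]"

definition euclidean_gauss_wantzel :: "nat set" where
  "euclidean_gauss_wantzel =
     {n. 1 < n \<and> (\<exists>k l m. l \<in> {0, 1} \<and> m \<in> {0, 1} \<and> n = 2 ^ k * 3 ^ l * 5 ^ m)}"

definition euclidean_consonant :: "rat set \<Rightarrow> bool" where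
  "euclidean_consonant \<sigma> \<longleftrightarrow>
     length (second_kepler_seq \<sigma>) = kepler_height \<sigma> + 1 \<and>
     set (second_kepler_seq \<sigma>) \<subseteq> euclidean_gauss_wantzel"

subsection \<open>Well-definedness\<close>

lemma octave_rel_equiv: "equiv {q. 0 < q} octave_rel"
proof (rule equivI)
  show "octave_rel \<subseteq> {q. 0 < q} \<times> {q. 0 < q}"
    by (auto simp: octave_rel_def)
  show "refl_on {q. 0 < q} octave_rel"
    by (auto simp: octave_rel_def refl_on_def intro: exI[of _ 0])
  show "sym octave_rel"
  proof (rule symI)
    fix p q assume "(p, q) \<in> octave_rel"
    then obtain n :: int where n: "0 < p" "0 < q" "p = 2 powi n * q"
      by (auto simp: octave_rel_def)
    have "q = 2 powi (- n) * p"
      using n by (simp add: power_int_minus field_simps)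
    with n show "(q, p) \<in> octave_rel"
      unfolding octave_rel_def by blast
  qed
  show "trans octave_rel"
  proof (rule transI)
    fix p q r assume "(p, q) \<in> octave_rel" "(q, r) \<in> octave_rel"
    then obtain n k :: int where n: "0 < p" "0 < r" "p = 2 powi n * q" "q = 2 powi k * r"
      by (auto simp: octave_rel_def)
    then have "p = 2 powi (n + k) * r"
      by (simp add: power_int_add)
    with n show "(p, r) \<in> octave_rel"
      unfolding octave_rel_def by blast
  qed
qed

lemma musical_interval_eq_iff:
  assumes "0 < p" "0 < q"
  shows "musical_interval p = musical_interval q \<longleftrightarrow> (\<exists>n::int. p = 2 powi n * q)"
proof -
  have "musical_interval p = musical_interval q \<longleftrightarrow> (p, q) \<in> octave_rel"
    unfolding musical_interval_def using eq_equiv_class_iff[OF octave_rel_equiv] assms by simp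
  then show ?thesis
    using assms by (simp add: octave_rel_def)
qed

lemma musical_interval_in_carrier: "0 < q \<Longrightarrow> musical_interval q \<in> carrier musical_group"
  by (simp add: musical_group_def musical_interval_def quotientI)

lemma musical_group_carrierE:
  assumes "\<sigma> \<in> carrier musical_group"
  obtains q where "0 < q" "\<sigma> = musical_interval q"
  using assms by (auto simp: musical_group_def musical_interval_def elim!: quotientE)

lemma mem_musical_interval: "0 < q \<Longrightarrow> q \<in> musical_interval q"
  by (auto simp: musical_interval_def octave_rel_def intro: exI[of _ 0])

lemma musical_interval_memD:
  "p \<in> musical_interval q \<Longrightarrow> 0 < p \<and> musical_interval p = musical_interval q"
proof -
  assume "p \<in> musical_interval q"
  then have qp: "(q, p) \<in> octave_rel"
    by (simp add: musical_interval_def)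
  then have "musical_interval q = musical_interval p"
    unfolding musical_interval_def by (rule equiv_class_eq[OF octave_rel_equiv])
  moreover have "0 < p"
    using qp by (simp add: octave_rel_def)
  ultimately show ?thesis
    by simp
qed

lemma musical_group_mult:
  assumes "0 < p" "0 < q"
  shows "musical_interval p \<otimes>\<^bsub>musical_group\<^esub> musical_interval q = musical_interval (p * q)"
proof -
  have "musical_interval (a * b) = musical_interval (p * q)"
    if "a \<in> musical_interval p" "b \<in> musical_interval q" for a b
  proof -
    from that have pos: "0 < a" "0 < b" "musical_interval a = musical_interval p"
      "musical_interval b = musical_interval q"
      using musical_interval_memD by auto
    then obtain n k :: int where "a = 2 powi n * p" "b = 2 powi k * q"
      using musical_interval_eq_iff assms by metis
    then have "a * b = 2 powi (n + k) * (p * q)"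
      by (simp add: power_int_add)
    then show ?thesis
      using musical_interval_eq_iff[of "a * b" "p * q"] pos assms by auto
  qed
  then have "(\<Union>a\<in>musical_interval p. \<Union>b\<in>musical_interval q. musical_interval (a * b)) =
      musical_interval (p * q)"
    using mem_musical_interval assms by blast
  then show ?thesis
    by (simp add: musical_group_def)
qed

lemma musical_group_one: "octave = musical_interval 1"
  by (simp add: musical_group_def)

lemma musical_group_comm_group: "comm_group musical_group"
proof (rule comm_groupI)
  show "octave \<in> carrier musical_group"
    by (simp add: musical_group_one musical_interval_in_carrier)
next
  fix \<sigma> assume "\<sigma> \<in> carrier musical_group"
  then obtain q where q: "0 < q" "\<sigma> = musical_interval q"
    by (rule musical_group_carrierE)
  then show "octave \<otimes>\<^bsub>musical_group\<^esub> \<sigma> = \<sigma>"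
    by (simp add: musical_group_one musical_group_mult)
  have "musical_interval (inverse q) \<otimes>\<^bsub>musical_group\<^esub> \<sigma> = octave"
    using q by (simp add: musical_group_one musical_group_mult)
  then show "\<exists>\<tau>\<in>carrier musical_group. \<tau> \<otimes>\<^bsub>musical_group\<^esub> \<sigma> = octave"
    using q musical_interval_in_carrier[of "inverse q"] by auto
next
  fix \<sigma> \<tau> assume "\<sigma> \<in> carrier musical_group" "\<tau> \<in> carrier musical_group"
  then obtain p q where "0 < p" "\<sigma> = musical_interval p" "0 < q" "\<tau> = musical_interval q"
    by (metis musical_group_carrierE)
  then show "\<sigma> \<otimes>\<^bsub>musical_group\<^esub> \<tau> \<in> carrier musical_group"
    and "\<sigma> \<otimes>\<^bsub>musical_group\<^esub> \<tau> = \<tau> \<otimes>\<^bsub>musical_group\<^esub> \<sigma>"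
    by (simp_all add: musical_group_mult musical_interval_in_carrier mult.commute)
next
  fix \<sigma> \<tau> \<upsilon>
  assume "\<sigma> \<in> carrier musical_group" "\<tau> \<in> carrier musical_group" "\<upsilon> \<in> carrier musical_group"
  then obtain p q r where "0 < p" "\<sigma> = musical_interval p" "0 < q" "\<tau> = musical_interval q"
    "0 < r" "\<upsilon> = musical_interval r"
    by (metis musical_group_carrierE)
  then show "\<sigma> \<otimes>\<^bsub>musical_group\<^esub> \<tau> \<otimes>\<^bsub>musical_group\<^esub> \<upsilon> =
      \<sigma> \<otimes>\<^bsub>musical_group\<^esub> (\<tau> \<otimes>\<^bsub>musical_group\<^esub> \<upsilon>)"
    by (simp add: musical_group_mult mult.assoc)
qed

lemma rat_power2_eq_imp_zero:
  fixes r s :: rat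
  assumes "1 / 2 \<le> r" "r < 1" "1 / 2 \<le> s" "s < 1" "r = 2 powi k * s"
  shows "k = 0"
proof (rule ccontr)
  assume "k \<noteq> 0"
  then consider "1 \<le> k" | "k \<le> -1" by linarith
  then show False
  proof cases
    case 1
    then have "(2::rat) powi 1 \<le> 2 powi k" by (intro power_int_increasing) auto
    then have "2 * s \<le> 2 powi k * s"
      using assms by (intro mult_right_mono) auto
    then show False using assms by linarith
  next
    case 2
    then have "(2::rat) powi k \<le> 2 powi (-1)" by (intro power_int_increasing) auto
    then have "2 powi k * s \<le> (1 / 2) * s"
      using assms by (intro mult_right_mono) (auto simp: power_int_minus)
    then show False using assms by linarith
  qed
qed

lemma octave_scaling_exists:
  fixes q :: rat
  assumes "0 < q"
  shows "\<exists>k::int. 1 / 2 \<le> 2 powi k * q \<and> 2 powi k * q < 1"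
proof -
  define x :: real where "x = of_rat q"
  have x: "0 < x" using assms by (simp add: x_def)
  define k where "k = - \<lfloor>log 2 x\<rfloor> - 1"
  have "real_of_int \<lfloor>log 2 x\<rfloor> \<le> log 2 x" "log 2 x < real_of_int \<lfloor>log 2 x\<rfloor> + 1"
    by linarith+
  then have l: "- 1 \<le> real_of_int k + log 2 x" "real_of_int k + log 2 x < 0"
    unfolding k_def of_int_diff of_int_minus of_int_1 by linarith+
  have e: "2 powi k * x = 2 powr (real_of_int k + log 2 x)"
    using x by (simp add: powr_add powr_real_of_int' )
  have "2 powr (-1) \<le> 2 powi k * x" "2 powi k * x < 2 powr 0"
    unfolding e using l by (intro powr_mono powr_less_mono; simp)+
  then have "1 / 2 \<le> 2 powi k * x" "2 powi k * x < 1"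
    by (simp_all add: powr_minus)
  moreover have "2 powi k * x = of_rat (2 powi k * q)"
    by (simp add: x_def of_rat_mult power_int_def of_rat_power of_rat_divide)
  moreover have "(1 / 2 :: real) = of_rat (1 / 2)"
    by (simp add: of_rat_divide)
  ultimately show ?thesis
    by (metis of_rat_less_eq of_rat_less of_rat_1)
qed

lemma normal_fraction_ex1:
  assumes "\<sigma> \<in> carrier musical_group"
  shows "\<exists>!mn. is_normal_fraction \<sigma> mn"
proof (rule ex_ex1I)
  obtain q where q: "0 < q" "\<sigma> = musical_interval q"
    using assms by (rule musical_group_carrierE)
  obtain k :: int where k: "1 / 2 \<le> 2 powi k * q" "2 powi k * q < 1"
    using octave_scaling_exists q by blast
  define r where "r = 2 powi k * q"
  obtain a b where ab: "quotient_of r = (a, b)" by (cases "quotient_of r")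
  have r: "r = of_int a / of_int b" using quotient_of_div[OF ab] .
  have b: "0 < b" using quotient_of_denom_pos[OF ab] .
  have cop: "coprime a b" using quotient_of_coprime[OF ab] .
  have "0 < r" using k by (simp add: r_def)
  then have a: "0 < a" using r b by (simp add: zero_less_divide_iff)
  have r': "r = of_nat (nat a) / of_nat (nat b)"
    using r a b by simp
  have "musical_interval r = \<sigma>"
    using musical_interval_eq_iff[of r q] q \<open>0 < r\<close> by (auto simp: r_def)
  moreover have "coprime (nat b) (nat a)"
    using cop a b by (simp add: coprime_int_iff[symmetric] coprime_commute del: coprime_int_iff)
  ultimately have "is_normal_fraction \<sigma> (nat a, nat b)"
    using a b k[folded r_def]
    unfolding is_normal_fraction_def prod.case r'[symmetric] by simp
  then show "\<exists>mn. is_normal_fraction \<sigma> mn" ..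
next
  fix x y assume xy: "is_normal_fraction \<sigma> x" "is_normal_fraction \<sigma> y"
  obtain m n m' n' where [simp]: "x = (m, n)" "y = (m', n')" by (cases x, cases y)
  define r s :: rat where "r = of_nat m / of_nat n" and "s = of_nat m' / of_nat n'"
  have d: "0 < m" "0 < n" "0 < m'" "0 < n'" "coprime n m" "coprime n' m'"
    "1 / 2 \<le> r" "r < 1" "1 / 2 \<le> s" "s < 1" "musical_interval r = musical_interval s"
    using xy by (auto simp: is_normal_fraction_def r_def s_def)
  then obtain k :: int where "r = 2 powi k * s"
    using musical_interval_eq_iff[of r s] by auto
  then have "r = s"
    using rat_power2_eq_imp_zero[of r s k] d by auto
  then have "(of_nat (m * n') :: rat) = of_nat (m' * n)"
    using d by (simp add: r_def s_def field_simps)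
  then have eq: "m * n' = m' * n" unfolding of_nat_eq_iff .
  then have "m = m'" "n = n'"
    using d by (metis coprime_crossproduct_nat coprime_commute mult.commute)+
  then show "x = y" by simp
qed

lemma normal_fraction:
  assumes "\<sigma> \<in> carrier musical_group"
  shows "is_normal_fraction \<sigma> (interval_num \<sigma>, interval_den \<sigma>)"
  using theI'[OF normal_fraction_ex1[OF assms]]
  by (simp add: interval_num_def interval_den_def)

lemma normal_fraction_unique:
  assumes "is_normal_fraction \<sigma> (m, n)"
  shows "interval_num \<sigma> = m" "interval_den \<sigma> = n"
proof -
  have "\<sigma> \<in> carrier musical_group"
    using assms musical_interval_in_carrier by (auto simp: is_normal_fraction_def)
  then have "(THE mn. is_normal_fraction \<sigma> mn) = (m, n)"
    using normal_fraction_ex1 assms by (blast intro: the1_equality)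
  then show "interval_num \<sigma> = m" "interval_den \<sigma> = n"
    by (simp_all add: interval_num_def interval_den_def)
qed

lemma interval_num_less_den:
  assumes "\<sigma> \<in> carrier musical_group"
  shows "0 < interval_num \<sigma>" "interval_num \<sigma> < interval_den \<sigma>"
  using normal_fraction[OF assms] by (auto simp: is_normal_fraction_def field_simps)

lemma kepler_in_carrier:
  assumes "\<sigma> \<in> carrier musical_group"
  shows "kepler \<sigma> \<in> carrier musical_group"
  using interval_num_less_den[OF assms] unfolding kepler_def
  by (intro musical_interval_in_carrier) simp

lemma octave_half: "octave = musical_interval (1 / 2)"
  unfolding musical_group_one
  using musical_interval_eq_iff[of 1 "1 / 2"] by (auto intro: exI[of _ 1])

lemma normal_fraction_octave: "is_normal_fraction octave (1, 2)"
  by (simp add: is_normal_fraction_def octave_half)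

lemma interval_den_kepler_less:
  assumes s: "\<sigma> \<in> carrier musical_group" and ne: "\<sigma> \<noteq> octave"
  shows "kepler \<sigma> = octave \<or> interval_den (kepler \<sigma>) < interval_den \<sigma>"
proof -
  define m n where "m = interval_num \<sigma>" and "n = interval_den \<sigma>"
  have mn: "0 < m" "m < n" using interval_num_less_den[OF s] by (auto simp: m_def n_def)
  have half: "n \<le> 2 * m" and sig: "\<sigma> = musical_interval (of_nat m / of_nat n)"
  proof -
    have nf: "is_normal_fraction \<sigma> (m, n)" unfolding m_def n_def using s by (rule normal_fraction)
    then have "(1 / 2 :: rat) \<le> of_nat m / of_nat n"
      by (simp add: is_normal_fraction_def)
    then have "(of_nat n :: rat) \<le> of_nat (2 * m)"
      using mn by (simp add: field_simps)
    then show "n \<le> 2 * m" unfolding of_nat_le_iff .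
    show "\<sigma> = musical_interval (of_nat m / of_nat n)"
      using nf by (simp add: is_normal_fraction_def)
  qed
  define q :: rat where "q = of_nat (n - m) / of_nat m"
  have q: "0 < q" "q \<le> 1"
    using mn half by (auto simp: q_def field_simps)
  have K: "kepler \<sigma> = musical_interval q"
    using mn by (simp add: kepler_def q_def m_def n_def of_nat_diff)
  show ?thesis
  proof (cases "q = 1")
    case True
    then show ?thesis using K musical_group_one by simp
  next
    case False
    obtain k :: int where k: "1 / 2 \<le> 2 powi k * q" "2 powi k * q < 1"
      using octave_scaling_exists q by blast
    have "0 \<le> k"
    proof (rule ccontr)
      assume "\<not> 0 \<le> k"
      then have "(2::rat) powi k \<le> 2 powi (-1)" by (intro power_int_increasing) auto
      then have "2 powi k * q \<le> 1 / 2 * q"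
        using q by (intro mult_right_mono) (auto simp: power_int_minus)
      then show False using k q False by linarith
    qed
    then obtain j where j: "k = int j" using nonneg_int_cases by blast
    have Kc: "kepler \<sigma> \<in> carrier musical_group" using s by (rule kepler_in_carrier)
    define u v where "u = interval_num (kepler \<sigma>)" and "v = interval_den (kepler \<sigma>)"
    have uv: "0 < u" "u < v" using interval_num_less_den[OF Kc] by (auto simp: u_def v_def)
    have nf: "is_normal_fraction (kepler \<sigma>) (u, v)"
      unfolding u_def v_def using Kc by (rule normal_fraction)
    define r :: rat where "r = of_nat u / of_nat v"
    have r: "1 / 2 \<le> r" "r < 1" "musical_interval r = musical_interval q" "coprime v u"
      using nf K by (auto simp: is_normal_fraction_def r_def)
    define t where "t = 2 powi k * q"
    have t: "0 < t" "musical_interval t = musical_interval q"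
      using q musical_interval_eq_iff[of t q] by (auto simp: t_def)
    then obtain i :: int where "r = 2 powi i * t"
      using musical_interval_eq_iff[of r t] r by auto
    then have "r = t"
      using rat_power2_eq_imp_zero[of r t i] r k by (auto simp: t_def)
    then have "(of_nat (u * m) :: rat) = of_nat (v * (2 ^ j * (n - m)))"
      using uv mn by (simp add: r_def t_def q_def j field_simps)
    then have "u * m = v * (2 ^ j * (n - m))" unfolding of_nat_eq_iff .
    then have "v dvd m" using r(4)
      by (metis coprime_dvd_mult_right_iff dvd_triv_left)
    then have "v \<le> m" using mn by (simp add: dvd_imp_le)
    then show ?thesis using mn by (simp add: v_def n_def)
  qed
qed

text \<open>The set over which the height minimises is nonempty.\<close>

lemma kepler_reaches_octave:
  assumes "\<sigma> \<in> carrier musical_group"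
  shows "\<exists>l. (kepler ^^ l) \<sigma> = octave"
  using assms
proof (induction "interval_den \<sigma>" arbitrary: \<sigma> rule: less_induct)
  case less
  show ?case
  proof (cases "\<sigma> = octave")
    case True
    then have "(kepler ^^ 0) \<sigma> = octave" by simp
    then show ?thesis by blast
  next
    case False
    then consider "kepler \<sigma> = octave" | "interval_den (kepler \<sigma>) < interval_den \<sigma>"
      using interval_den_kepler_less less.prems by blast
    then show ?thesis
    proof cases
      case 1
      then have "(kepler ^^ 1) \<sigma> = octave" by simp
      then show ?thesis by blast
    next
      case 2
      then obtain l where "(kepler ^^ l) (kepler \<sigma>) = octave"
        using less kepler_in_carrier by blast
      then have "(kepler ^^ Suc l) \<sigma> = octave" by (simp add: funpow_swap1)
      then show ?thesis by blast
    qed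
  qed
qed

end

theory Submission
  imports Defs
begin

text \<open>If \<open>m/n\<close> is the normal fraction of \<open>\<sigma>\<close> and \<open>m > 1\<close> is odd, then \<open>K \<sigma>\<close> has denominator
  \<open>m\<close>, since moving \<open>(n - m)/m\<close> into \<open>[1/2, 1)\<close> only introduces powers of two in the numerator; so if
  \<open>\<sigma>\<close> is consonant, \<open>m\<close> is an odd Gauss-Wantzel number, that is, 3, 5 or 15. If \<open>m\<close> is even, then
  \<open>n\<close> is odd and hence itself 3, 5 or 15. As \<open>m < n \<le> 2m\<close>, finitely many fractions remain; besides
  the seven consonants these are \<open>8/15\<close>, \<open>14/15\<close> and \<open>15/16\<close>, whose orbits under \<open>K\<close> reach
  \<open>[4/7]\<close>.\<close>

section \<open>Normal fractions and the Kepler map\<close>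

text \<open>Clearing denominators turns the rational bounds into inequalities between natural
  numbers, which also encode that \<open>m\<close> and \<open>n\<close> are positive.\<close>

lemma is_normal_fraction_iff:
  "is_normal_fraction \<sigma> (m, n) \<longleftrightarrow>
     \<sigma> = musical_interval (of_nat m / of_nat n) \<and> m < n \<and> n \<le> 2 * m \<and> coprime n m"
proof -
  have "(1 / 2 \<le> (of_nat m / of_nat n :: rat) \<and> (of_nat m / of_nat n :: rat) < 1) \<longleftrightarrow>
      n \<le> 2 * m \<and> m < n" if "0 < n"
  proof -
    have "1 / 2 \<le> (of_nat m / of_nat n :: rat) \<longleftrightarrow> (of_nat n :: rat) \<le> of_nat (2 * m)"
      using that by (simp add: field_simps)
    moreover have "(of_nat m / of_nat n :: rat) < 1 \<longleftrightarrow> m < n"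
      using that by (simp add: field_simps)
    ultimately show ?thesis
      unfolding of_nat_le_iff by simp
  qed
  then show ?thesis
    unfolding is_normal_fraction_def prod.case by (cases "n = 0") auto
qed

lemma kepler_normal_fraction:
  assumes "is_normal_fraction \<sigma> (m, n)"
  shows "kepler \<sigma> = musical_interval (of_nat (n - m) / of_nat m)"
  using assms normal_fraction_unique[OF assms]
  by (simp add: kepler_def is_normal_fraction_iff of_nat_diff)

text \<open>The hypothesis \<open>eq\<close> is \<open>u / v = 2 ^ j * ((n - m) / m)\<close> with
  denominators cleared, so concrete instances are plain arithmetic. As \<open>(n - m) / m\<close> is
  at most 1, a natural exponent \<open>j\<close> covers every interval but the octave, where the
  exponent would be -1.\<close>

lemma is_normal_fraction_keplerI:
  assumes "is_normal_fraction \<sigma> (m, n)"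
    and uv: "u < v" "v \<le> 2 * u" "coprime v u"
    and eq: "u * m = 2 ^ j * (n - m) * v"
  shows "is_normal_fraction (kepler \<sigma>) (u, v)"
proof -
  have mn: "0 < m" "m < n"
    using assms(1) by (auto simp: is_normal_fraction_iff)
  have "(of_nat (u * m) :: rat) = of_nat (2 ^ j * (n - m) * v)"
    using eq by simp
  then have "(of_nat u / of_nat v :: rat) = 2 powi int j * (of_nat (n - m) / of_nat m)"
    using uv mn by (simp add: field_simps)
  then have "musical_interval (of_nat u / of_nat v) = musical_interval (of_nat (n - m) / of_nat m)"
    using uv mn by (subst musical_interval_eq_iff) (auto intro!: exI[of _ "int j"])
  then show ?thesis
    using uv kepler_normal_fraction[OF assms(1)] by (simp add: is_normal_fraction_iff)
qed

lemma interval_den_kepler_odd: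
  assumes nf: "is_normal_fraction \<sigma> (m, n)" and m: "odd m" "1 < m"
  shows "interval_den (kepler \<sigma>) = m"
proof -
  have mn: "m < n" "n \<le> 2 * m" "coprime n m"
    using nf by (auto simp: is_normal_fraction_iff)
  then have cop: "coprime m (n - m)"
    by (metis coprime_commute gcd_diff1_nat coprime_iff_gcd_eq_1 less_imp_le_nat)
  \<comment> \<open>Otherwise \<open>m\<close> would divide both of the coprime numbers, forcing
    \<open>m = 1\<close>.\<close>
  have "n \<noteq> 2 * m"
    using mn m by auto
  with mn have small: "n - m < m" "0 < n - m"
    by auto
  \<comment> \<open>The least number of doublings that lifts \<open>(n - m) / m\<close> to at least
    1/2; minimality will keep the result below 1.\<close>
  define j where "j = (LEAST j. m \<le> 2 * (2 ^ j * (n - m)))"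
  have "m \<le> 2 * (2 ^ m * (n - m))"
  proof -
    have "m * 1 \<le> 2 ^ m * (n - m)"
      using small by (intro mult_mono) (auto intro: less_imp_le)
    then show ?thesis by simp
  qed
  then have j: "m \<le> 2 * (2 ^ j * (n - m))"
    unfolding j_def by (rule LeastI)
  have "2 ^ j * (n - m) < m"
  proof (cases j)
    case 0
    then show ?thesis using small by simp
  next
    case (Suc i)
    have "\<not> m \<le> 2 * (2 ^ i * (n - m))"
      using Suc by (intro not_less_Least) (simp add: j_def)
    then show ?thesis using Suc by simp
  qed
  \<comment> \<open>Oddness of \<open>m\<close> enters here: the factor \<open>2 ^ j\<close> cancels
    nothing.\<close>
  moreover have "coprime m (2 ^ j * (n - m))"
    using cop m by simp
  ultimately have "is_normal_fraction (kepler \<sigma>) (2 ^ j * (n - m), m)"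
    using j by (intro is_normal_fraction_keplerI[OF nf]) auto
  then show ?thesis
    by (rule normal_fraction_unique)
qed

section \<open>Consonance along Kepler orbits\<close>

lemma kepler_octave: "kepler octave = octave"
  using kepler_normal_fraction[OF normal_fraction_octave] by (simp add: musical_group_one)

text \<open>The octave is a fixed point of \<open>kepler\<close>, so beyond the height the
  denominators only repeat the last entry. This removes the height from all later arguments.\<close>

lemma euclidean_consonant_iff:
  assumes "\<sigma> \<in> carrier musical_group"
  shows "euclidean_consonant \<sigma> \<longleftrightarrow>
    (\<forall>j. interval_den ((kepler ^^ j) \<sigma>) \<in> euclidean_gauss_wantzel)"
proof -
  define h where "h = kepler_height \<sigma>"
  have h: "(kepler ^^ h) \<sigma> = octave"
    unfolding h_def kepler_height_def using kepler_reaches_octave[OF assms] by (rule LeastI_ex)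
  have stable: "(kepler ^^ (i + h)) \<sigma> = octave" for i
    by (induction i) (simp_all add: h kepler_octave)
  have eventually: "(kepler ^^ j) \<sigma> = (kepler ^^ h) \<sigma>" if "h \<le> j" for j
    using stable[of "j - h"] that h by simp
  have "euclidean_consonant \<sigma> \<longleftrightarrow>
      (\<forall>j\<le>h. interval_den ((kepler ^^ j) \<sigma>) \<in> euclidean_gauss_wantzel)"
    unfolding euclidean_consonant_def second_kepler_seq_def h_def[symmetric]
    by (auto simp: image_subset_iff less_Suc_eq_le simp del: upt_Suc)
  also have "\<dots> \<longleftrightarrow> (\<forall>j. interval_den ((kepler ^^ j) \<sigma>) \<in> euclidean_gauss_wantzel)"
    using eventually by (metis le_cases order_refl)
  finally show ?thesis .
qed

lemma euclidean_consonantD: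
  assumes "\<sigma> \<in> carrier musical_group" "euclidean_consonant \<sigma>"
  shows "interval_den \<sigma> \<in> euclidean_gauss_wantzel" "euclidean_consonant (kepler \<sigma>)"
proof -
  have *: "interval_den ((kepler ^^ j) \<sigma>) \<in> euclidean_gauss_wantzel" for j
    using assms euclidean_consonant_iff by blast
  show "interval_den \<sigma> \<in> euclidean_gauss_wantzel"
    using *[of 0] by simp
  have "interval_den ((kepler ^^ j) (kepler \<sigma>)) \<in> euclidean_gauss_wantzel" for j
    using *[of "Suc j"] by (simp add: funpow_swap1)
  then show "euclidean_consonant (kepler \<sigma>)"
    using euclidean_consonant_iff kepler_in_carrier assms(1) by blast
qed

text \<open>A \<open>kepler\<close>-stable set contains the whole orbit of each of its members, so
  consonance can be checked one step at a time.\<close>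

lemma euclidean_consonant_coinduct:
  assumes "\<sigma> \<in> S" "S \<subseteq> carrier musical_group"
    and "\<And>\<tau>. \<tau> \<in> S \<Longrightarrow> interval_den \<tau> \<in> euclidean_gauss_wantzel \<and> kepler \<tau> \<in> S"
  shows "euclidean_consonant \<sigma>"
proof -
  have "(kepler ^^ j) \<sigma> \<in> S" for j
    using assms by (induction j) auto
  then show ?thesis
    using assms euclidean_consonant_iff by blast
qed

section \<open>Arithmetic of Gauss-Wantzel numbers\<close>

lemma odd_gauss_wantzel_iff:
  assumes "odd n"
  shows "n \<in> euclidean_gauss_wantzel \<longleftrightarrow> n \<in> {3, 5, 15}"
proof
  assume "n \<in> euclidean_gauss_wantzel"
  then obtain k l m where "1 < n" "l \<in> {0, 1}" "m \<in> {0, 1}" "n = 2 ^ k * 3 ^ l * 5 ^ m"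
    by (auto simp: euclidean_gauss_wantzel_def)
  with assms show "n \<in> {3, 5, 15}"
    \<comment> \<open>A positive \<open>k\<close> would make \<open>n\<close> even;
      \<open>k = 0\<close> leaves 1, 3, 5, 15, and \<open>1 < n\<close> rules out 1.\<close>
    by (cases k) auto
next
  have "n \<in> euclidean_gauss_wantzel" if "1 < n" "n = 2 ^ 0 * 3 ^ l * 5 ^ m" "l \<in> {0, 1}" "m \<in> {0, 1}" for l m
    using that unfolding euclidean_gauss_wantzel_def by blast
  from this[of 1 0] this[of 0 1] this[of 1 1]
  show "n \<in> {3, 5, 15} \<Longrightarrow> n \<in> euclidean_gauss_wantzel"
    by auto
qed

text \<open>Removing factors of two one by one reduces membership to the odd case. The alternative
  \<open>n = 1\<close> accounts for 2, whose half lies outside the set.\<close>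

lemma double_gauss_wantzel_iff:
  "2 * n \<in> euclidean_gauss_wantzel \<longleftrightarrow> n = 1 \<or> n \<in> euclidean_gauss_wantzel"
proof
  assume "2 * n \<in> euclidean_gauss_wantzel"
  then obtain k l m where *: "1 < 2 * n" "l \<in> {0, 1}" "m \<in> {0, 1}" "2 * n = 2 ^ k * 3 ^ l * 5 ^ m"
    by (auto simp: euclidean_gauss_wantzel_def)
  show "n = 1 \<or> n \<in> euclidean_gauss_wantzel"
  proof (cases k)
    case 0
    with * have "odd (2 * n)" by simp
    then show ?thesis by simp
  next
    case (Suc i)
    with * have "n = 2 ^ i * 3 ^ l * 5 ^ m" by simp
    moreover have "n = 1 \<or> 1 < n" using *(1) by linarith
    ultimately show ?thesis
      using *(2,3) unfolding euclidean_gauss_wantzel_def by blast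
  qed
next
  assume "n = 1 \<or> n \<in> euclidean_gauss_wantzel"
  then obtain k l m where *: "1 \<le> n" "l \<in> {0, 1}" "m \<in> {0, 1}" "n = 2 ^ k * 3 ^ l * 5 ^ m"
    by (fastforce simp: euclidean_gauss_wantzel_def)
  then have "1 < 2 * n" "2 * n = 2 ^ Suc k * 3 ^ l * 5 ^ m"
    by (linarith, simp)
  with * show "2 * n \<in> euclidean_gauss_wantzel"
    unfolding euclidean_gauss_wantzel_def by blast
qed

text \<open>The members are the denominators of the seven consonants; the non-members are the even
  numbers from 17 to 30 that are coprime to 15.\<close>

lemma gauss_wantzel_small:
  "2 \<in> euclidean_gauss_wantzel" "3 \<in> euclidean_gauss_wantzel" "4 \<in> euclidean_gauss_wantzel"
  "5 \<in> euclidean_gauss_wantzel" "6 \<in> euclidean_gauss_wantzel" "8 \<in> euclidean_gauss_wantzel"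
  "22 \<notin> euclidean_gauss_wantzel" "26 \<notin> euclidean_gauss_wantzel" "28 \<notin> euclidean_gauss_wantzel"
  using double_gauss_wantzel_iff[of 1] double_gauss_wantzel_iff[of 2]
    double_gauss_wantzel_iff[of 3] double_gauss_wantzel_iff[of 4] double_gauss_wantzel_iff[of 7]
    double_gauss_wantzel_iff[of 11] double_gauss_wantzel_iff[of 13] double_gauss_wantzel_iff[of 14]
  by (simp_all add: odd_gauss_wantzel_iff)

lemma coprime_numerals:
  "coprime (5::nat) 3" "coprime (6::nat) 5" "coprime (5::nat) 4" "coprime (4::nat) 3" "coprime (3::nat) 2"
  "coprime (8::nat) 5" "coprime (8::nat) 7" "coprime (7::nat) 4" "coprime (15::nat) 8"
  "\<not> coprime (6::nat) 3" "\<not> coprime (10::nat) 5" "\<not> coprime (15::nat) 10" "\<not> coprime (15::nat) 12"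
  "\<not> coprime (18::nat) 15" "\<not> coprime (20::nat) 15" "\<not> coprime (21::nat) 15"
  "\<not> coprime (24::nat) 15" "\<not> coprime (25::nat) 15" "\<not> coprime (27::nat) 15" "\<not> coprime (30::nat) 15"
  by code_simp+

section \<open>The orbits of the seven consonants\<close>

lemma consonant_normal_fractions:
  "is_normal_fraction (musical_interval (5 / 6)) (5, 6)"
  "is_normal_fraction (musical_interval (4 / 5)) (4, 5)"
  "is_normal_fraction (musical_interval (3 / 4)) (3, 4)"
  "is_normal_fraction (musical_interval (2 / 3)) (2, 3)"
  "is_normal_fraction (musical_interval (5 / 8)) (5, 8)"
  "is_normal_fraction (musical_interval (3 / 5)) (3, 5)"
  "is_normal_fraction (musical_interval (1 / 2)) (1, 2)"
  by (simp_all add: is_normal_fraction_iff coprime_numerals)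

lemma normal_fraction_inj:
  assumes "is_normal_fraction \<sigma> mn" "is_normal_fraction \<tau> mn"
  shows "\<sigma> = \<tau>"
  using assms by (cases mn) (simp add: is_normal_fraction_iff)

text \<open>Both sides are compared through their normal fractions; \<open>j\<close> is the number
  of octaves by which \<open>(n - m) / m\<close> is raised to reach \<open>[1/2, 1)\<close>.\<close>

lemma kepler_consonants:
  "kepler (musical_interval (5 / 6)) = musical_interval (4 / 5)"
  "kepler (musical_interval (4 / 5)) = musical_interval (1 / 2)"
  "kepler (musical_interval (3 / 4)) = musical_interval (2 / 3)"
  "kepler (musical_interval (2 / 3)) = musical_interval (1 / 2)"
  "kepler (musical_interval (5 / 8)) = musical_interval (3 / 5)"
  "kepler (musical_interval (3 / 5)) = musical_interval (2 / 3)"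
  "kepler (musical_interval (1 / 2)) = musical_interval (1 / 2)"
proof -
  note nf = consonant_normal_fractions
  show "kepler (musical_interval (5 / 6)) = musical_interval (4 / 5)"
    by (rule normal_fraction_inj[OF is_normal_fraction_keplerI[where j = 2, OF nf(1)] nf(2)])
      (simp_all add: coprime_numerals)
  show "kepler (musical_interval (4 / 5)) = musical_interval (1 / 2)"
    by (rule normal_fraction_inj[OF is_normal_fraction_keplerI[where j = 1, OF nf(2)] nf(7)])
      (simp_all add: coprime_numerals)
  show "kepler (musical_interval (3 / 4)) = musical_interval (2 / 3)"
    by (rule normal_fraction_inj[OF is_normal_fraction_keplerI[where j = 1, OF nf(3)] nf(4)])
      (simp_all add: coprime_numerals)
  show "kepler (musical_interval (2 / 3)) = musical_interval (1 / 2)"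
    by (rule normal_fraction_inj[OF is_normal_fraction_keplerI[where j = 0, OF nf(4)] nf(7)])
      (simp_all add: coprime_numerals)
  show "kepler (musical_interval (5 / 8)) = musical_interval (3 / 5)"
    by (rule normal_fraction_inj[OF is_normal_fraction_keplerI[where j = 0, OF nf(5)] nf(6)])
      (simp_all add: coprime_numerals)
  show "kepler (musical_interval (3 / 5)) = musical_interval (2 / 3)"
    by (rule normal_fraction_inj[OF is_normal_fraction_keplerI[where j = 0, OF nf(6)] nf(4)])
      (simp_all add: coprime_numerals)
  show "kepler (musical_interval (1 / 2)) = musical_interval (1 / 2)"
    using kepler_octave by (simp add: octave_half)
qed

section \<open>Exclusion of all other intervals\<close>

text \<open>The argument inspects at most the first two entries of the Kepler sequence, which is why
  three fractions that are not consonant survive.\<close>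

lemma euclidean_consonant_fractions:
  assumes c: "euclidean_consonant \<sigma>" and nf: "is_normal_fraction \<sigma> (m, n)"
  shows "(m, n) \<in> {(5, 6), (4, 5), (3, 4), (2, 3), (5, 8), (3, 5), (1, 2),
                    (8, 15), (14, 15), (15, 16)}"
proof -
  have s: "\<sigma> \<in> carrier musical_group"
    using nf musical_interval_in_carrier by (auto simp: is_normal_fraction_iff)
  have mn: "m < n" "n \<le> 2 * m" "coprime n m"
    using nf by (auto simp: is_normal_fraction_iff)
  have n: "n \<in> euclidean_gauss_wantzel"
    using euclidean_consonantD(1)[OF s c] normal_fraction_unique[OF nf] by simp
  consider "even m" | "m = 1" | "odd m" "1 < m"
    using mn by fastforce
  then show ?thesis
  proof cases
    case 1
    then have "odd n"
      using mn coprime_common_divisor_nat[of n m 2] by auto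
    then have "n \<in> {3, 5, 15}"
      using n odd_gauss_wantzel_iff by blast
    moreover have "m = 2" if "n = 3"
      using that mn 1 by presburger
    moreover have "m = 4" if "n = 5"
      using that mn 1 by presburger
    moreover have "m \<in> {8, 14}" if "n = 15"
    proof -
      have "m = 8 \<or> m = 10 \<or> m = 12 \<or> m = 14"
        using that mn(1,2) 1 by presburger
      then show ?thesis
        using that mn(3) coprime_numerals by auto
    qed
    ultimately show ?thesis by blast
  next
    case 2
    then show ?thesis using mn by simp
  next
    case 3
    \<comment> \<open>For odd \<open>m > 1\<close> the second entry of the sequence is
      \<open>m\<close> itself.\<close>
    have "m \<in> euclidean_gauss_wantzel"
      using euclidean_consonantD[OF kepler_in_carrier[OF s] euclidean_consonantD(2)[OF s c]]
        interval_den_kepler_odd[OF nf 3] by simp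
    then have "m \<in> {3, 5, 15}"
      using 3 odd_gauss_wantzel_iff by blast
    moreover have "n \<in> {4, 5}" if "m = 3"
    proof -
      have "n \<noteq> 6"
        using mn(3) that coprime_numerals by auto
      with mn that show ?thesis by auto
    qed
    moreover have "n \<in> {6, 8}" if "m = 5"
    proof -
      have "n = 6 \<or> n = 7 \<or> n = 8 \<or> n = 9 \<or> n = 10"
        using mn(1,2) that by presburger
      moreover have "n \<noteq> 10"
        using mn(3) that coprime_numerals by auto
      ultimately show ?thesis
        using n by (auto simp: odd_gauss_wantzel_iff)
    qed
    moreover have "n = 16" if "m = 15"
    proof -
      \<comment> \<open>Odd candidates are not among 3, 5, 15; multiples of 3 or 5 violate
        coprimality; 22, 26 and 28 are not Gauss-Wantzel numbers.\<close>
      have "n = 16 \<or> n = 17 \<or> n = 18 \<or> n = 19 \<or> n = 20 \<or> n = 21 \<or> n = 22 \<or> n = 23 \<or>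
          n = 24 \<or> n = 25 \<or> n = 26 \<or> n = 27 \<or> n = 28 \<or> n = 29 \<or> n = 30"
        using mn(1,2) that by presburger
      then show ?thesis
        using n mn(3) that
        by (auto simp: odd_gauss_wantzel_iff gauss_wantzel_small coprime_numerals)
    qed
    ultimately show ?thesis by blast
  qed
qed

text \<open>The orbits run 15/16, 8/15, 7/8 and 14/15, 4/7. Neither 7/8 nor 4/7 is among the ten
  fractions found above, and consonance is inherited along orbits.\<close>

lemma not_euclidean_consonant_fractions:
  assumes c: "euclidean_consonant \<sigma>" and nf: "is_normal_fraction \<sigma> (m, n)"
  shows "(m, n) \<notin> {(8, 15), (14, 15), (15, 16)}"
proof -
  have step: "euclidean_consonant (kepler \<tau>)"
    if "euclidean_consonant \<tau>" "is_normal_fraction \<tau> (u, v)" for \<tau> u v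
    using that euclidean_consonantD(2) musical_interval_in_carrier
    by (auto simp: is_normal_fraction_iff)
  have no47: False if "euclidean_consonant \<tau>" "is_normal_fraction \<tau> (4, 7)" for \<tau>
    using euclidean_consonant_fractions[OF that] by simp
  have no78: False if "euclidean_consonant \<tau>" "is_normal_fraction \<tau> (7, 8)" for \<tau>
    using euclidean_consonant_fractions[OF that] by simp
  have no815: False if "euclidean_consonant \<tau>" "is_normal_fraction \<tau> (8, 15)" for \<tau>
    using step[OF that]
    by (rule no78)
      (rule is_normal_fraction_keplerI[OF that(2), where j = 0],
        simp_all add: coprime_numerals)
  \<comment> \<open>Raising 1/14 by three octaves gives 8/14, which reduces to 4/7.\<close>
  have no1415: False if "euclidean_consonant \<tau>" "is_normal_fraction \<tau> (14, 15)" for \<tau>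
    using step[OF that]
    by (rule no47)
      (rule is_normal_fraction_keplerI[OF that(2), where j = 3],
        simp_all add: coprime_numerals)
  have no1516: False if "euclidean_consonant \<tau>" "is_normal_fraction \<tau> (15, 16)" for \<tau>
    using step[OF that]
    by (rule no815)
      (rule is_normal_fraction_keplerI[OF that(2), where j = 3],
        simp_all add: coprime_numerals)
  show ?thesis
    using c nf no815 no1415 no1516 by auto
qed

theorem theorem2p8:
  shows "{\<sigma> \<in> carrier musical_group. euclidean_consonant \<sigma>} =
      {musical_interval (5 / 6), musical_interval (4 / 5), musical_interval (3 / 4),
       musical_interval (2 / 3), musical_interval (5 / 8), musical_interval (3 / 5),
       musical_interval (1 / 2)}
    \<and> distinct
      [musical_interval (5 / 6), musical_interval (4 / 5), musical_interval (3 / 4),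
       musical_interval (2 / 3), musical_interval (5 / 8), musical_interval (3 / 5),
       musical_interval (1 / 2)]
    \<and> card {\<sigma> \<in> carrier musical_group. euclidean_consonant \<sigma>} = 7"
  (is "?C = ?S \<and> distinct ?xs \<and> _")
proof -
  note nf = consonant_normal_fractions
  define S where "S = ?S"
  have "?C \<subseteq> S"
  proof
    fix \<sigma> assume "\<sigma> \<in> ?C"
    then have s: "\<sigma> \<in> carrier musical_group" "euclidean_consonant \<sigma>"
      by auto
    obtain m n where mn: "is_normal_fraction \<sigma> (m, n)"
      using normal_fraction[OF s(1)] by blast
    then have "\<sigma> = musical_interval (of_nat m / of_nat n)"
      by (simp add: is_normal_fraction_iff)
    moreover have "(m, n) \<in> {(5, 6), (4, 5), (3, 4), (2, 3), (5, 8), (3, 5), (1, 2)}"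
      using euclidean_consonant_fractions[OF s(2) mn] not_euclidean_consonant_fractions[OF s(2) mn]
      by blast
    ultimately show "\<sigma> \<in> S"
      unfolding S_def by (elim insertE emptyE) simp_all
  qed
  moreover have sub: "S \<subseteq> carrier musical_group"
    by (simp add: S_def musical_interval_in_carrier)
  moreover have "euclidean_consonant \<sigma>" if "\<sigma> \<in> S" for \<sigma>
  \<comment> \<open>The seven classes form a \<open>kepler\<close>-stable set.\<close>
  proof (rule euclidean_consonant_coinduct[OF that sub])
    fix \<tau> assume "\<tau> \<in> S"
    then show "interval_den \<tau> \<in> euclidean_gauss_wantzel \<and> kepler \<tau> \<in> S"
      unfolding S_def by (elim insertE emptyE)
        (simp_all add: kepler_consonants gauss_wantzel_small nf[THEN normal_fraction_unique(2)])
  qed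
  ultimately have eq: "?C = S"
    by blast
  \<comment> \<open>The classes are separated by their pairs of normal numerator and
    denominator.\<close>
  have "distinct (map (\<lambda>\<sigma>. (interval_num \<sigma>, interval_den \<sigma>)) ?xs)"
    using nf[THEN normal_fraction_unique(1)] nf[THEN normal_fraction_unique(2)] by simp
  then have dist: "distinct ?xs"
    unfolding distinct_map by (rule conjunct1)
  have "card S = 7"
    using distinct_card[OF dist] by (simp add: S_def)
  with eq dist show ?thesis
    unfolding S_def by (intro conjI) simp_all
qed

end
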